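(* For $\lambda\in(0,1)$, the generalised Fisher Information satisfies: (i) $\mathscr R^\lambda_L$ is non-negative and lower-semicontinuous on $\mathcal P(\mathcal X)\times\mathcal P(\mathcal X)$. (ii) If $\mu,\rho\in\mathcal P(\mathcal X)$ with $\mathscr R^\lambda_L(\mu|\rho)=0$, then $\mu$ is a constant multiple of $\rho$ on each connected component of the support of $\rho$. In particular, if $\rho\in\mathcal P_+(\mathcal X)$, then $\mu=\rho$ on $\mathcal X$. (iii) $\mathscr R^\lambda_L\to\mathscr R_L$ as $\lambda\to0$ on $\mathcal P_+(\mathcal X)\times\mathcal P_+(\mathcal X)$ in the sense of Gamma convergence.
   Context: $\mathcal X$ is a finite or countable set. $\mathcal P(\mathcal X)$ is the set of probability measures on $\mathcal X$, viewed as a subset of $\ell^1(\mathcal X)$ with the $\ell^1$-topology; $\mathcal P_+(\mathcal X)$ is the subset of strictly positive ones. The generator $L\in\mathbb R^{\mathcal X\times\mathcal X}$ satisfies: (L1) $L(x,y)\ge0$ for $x\ne y$ and $\sum_{y}L(x,y)=0$ for all $x$; (L2) $\sup_x|L(x,x)|<\infty$; (L3) $L$ is irreducible (for all $x\neq y$ there is a finite chain $x=x_0,\dots,x_m=y$ with $L(x_k,x_{k+1})>0$). Generalised relative Fisher Information, for $\lambda\in(0,1)$ and $\mu,\rho\in\mathcal P(\mathcal X)$: $\mathscr R^\lambda_L(\mu|\rho)=\sum_{x,y\in\mathcal X}L(x,y)\psi_\lambda(x,y)$ (with $0\cdot\infty=0$), where - $\psi_\lambda(x,y)=\frac{\mu(y)}{\rho(y)}\rho(x)-\mu(x)-\frac1\lambda\Big(\mu(x)^{1-\lambda}\rho(x)^\lambda\big(\frac{\mu(y)}{\rho(y)}\big)^\lambda-\mu(x)\Big)$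 if $\rho(y)>0$ and $\rho(x)>0$; - $\psi_\lambda(x,y)=+\infty$ if $\rho(y)=0$, $\rho(x)>0$ and $\mu(y)>0$; - $\psi_\lambda(x,y)=0$ otherwise. (The terms with $x=y$ vanish.) Classical relative Fisher Information, for $\mu,\rho\in\mathcal P_+(\mathcal X)$ and $v=\mu/\rho$: $\mathscr R_L(\mu|\rho)=\sum_{x,y\in\mathcal X}\rho(x)L(x,y)\big[v(y)-v(x)-v(x)\log\frac{v(y)}{v(x)}\big]\in[0,\infty]$. Connected components: consider the undirected graph with vertex set $\mathcal X$ in which $x\neq y$ are joined by an edge iff $L(x,y)>0$ or $L(y,x)>0$; $\operatorname{supp}(\rho)=\{x:\rho(x)>0\}$ carries the induced subgraph, and its connected components are meant. Gamma convergence of $\mathscr R^\lambda_L$ to $\mathscr R_L$ as $\lambda\to0$ on $\mathcal P_+(\mathcal X)\times\mathcal P_+(\mathcal X)$ (with the $\ell^1$-topology) means: for all $\mu_\lambda\to\mu$, $\rho_\lambda\to\rho$ in $\mathcal P_+(\mathcal X)$ as $\lambda\to0$, $\liminf_{\lambda\to0}\mathscr R^\lambda_L(\mu_\lambda|\rho_\lambda)\ge\mathscr R_L(\mu|\rho)$; and for all $\mu,\rho\in\mathcal P_+(\mathcal X)$ there exist $\mu_\lambda\to\mu$, $\rho_\lambda\to\rho$ in $\mathcal P_+(\mathcal X)$ with $\limsup_{\lambda\to0}\mathscr R^\lambda_L(\mu_\lambda|\rho_\lambda)\le\mathscr R_L(\mu|\rho)$. *)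

theory Defs
  imports "HOL-Probability.Probability"
begin

text \<open>
  The state space is a type of class \<open>countable\<close> (finite or countably infinite), so that
  \<open>'a pmf\<close> is the set of all probability measures on it.
\<close>

definition generator :: "('a::countable \<Rightarrow> 'a \<Rightarrow> real) \<Rightarrow> bool" where
  "generator L \<longleftrightarrow>
     (\<forall>x y. x \<noteq> y \<longrightarrow> 0 \<le> L x y) \<and> (\<forall>x. ((\<lambda>y. L x y) has_sum 0) UNIV) \<and>
     bdd_above (range (\<lambda>x. \<bar>L x x\<bar>)) \<and>
     (\<forall>x y. x \<noteq> y \<longrightarrow> (\<lambda>u v. 0 < L u v)\<^sup>+\<^sup>+ x y)"

definition l1_dist :: "'a pmf \<Rightarrow> 'a pmf \<Rightarrow> real" where
  "l1_dist \<mu> \<nu> = (\<Sum>\<^sub>\<infinity>x. \<bar>pmf \<mu> x - pmf \<nu> x\<bar>)"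

lemma summable_on_abs_pmf_diff: "(\<lambda>x. \<bar>pmf \<mu> x - pmf \<nu> x\<bar>) summable_on UNIV"
proof -
  have s: "(\<lambda>x. pmf p x) summable_on UNIV" for p :: "'a pmf"
    using abs_summable_equivalent[of "pmf p" UNIV] pmf_abs_summable[of p UNIV]
    by simp
  show ?thesis
    by (rule summable_on_comparison_test[OF summable_on_add[OF s[of \<mu>] s[of \<nu>]]])
       (auto simp: abs_le_iff intro: add_increasing add_increasing2)
qed

lemma Metric_space_l1_dist: "Metric_space UNIV l1_dist"
proof
  fix p q r :: "'a pmf"
  show "0 \<le> l1_dist p q"
    unfolding l1_dist_def by (intro infsum_nonneg) auto
  show "l1_dist p q = l1_dist q p"
    unfolding l1_dist_def by (simp add: abs_minus_commute)
  show "l1_dist p q = 0 \<longleftrightarrow> p = q"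
  proof
    assume "l1_dist p q = 0"
    then have "\<bar>pmf p x - pmf q x\<bar> = 0" for x
      unfolding l1_dist_def
      by (intro nonneg_infsum_le_0D[OF _ summable_on_abs_pmf_diff]) auto
    then show "p = q" by (intro pmf_eqI) simp
  qed (simp add: l1_dist_def)
  have "l1_dist p r \<le> (\<Sum>\<^sub>\<infinity>x. \<bar>pmf p x - pmf q x\<bar> + \<bar>pmf q x - pmf r x\<bar>)"
    unfolding l1_dist_def
    by (intro infsum_mono summable_on_abs_pmf_diff summable_on_add) linarith
  also have "\<dots> = l1_dist p q + l1_dist q r"
    unfolding l1_dist_def by (intro infsum_add summable_on_abs_pmf_diff)
  finally show "l1_dist p r \<le> l1_dist p q + l1_dist q r" .
qed

definition l1_topology :: "'a pmf topology" where
  "l1_topology = Metric_space.mtopology UNIV l1_dist"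

definition positive_pmfs :: "'a pmf set" where
  "positive_pmfs = {\<mu>. \<forall>x. 0 < pmf \<mu> x}"

definition gen_psi :: "real \<Rightarrow> 'a pmf \<Rightarrow> 'a pmf \<Rightarrow> 'a \<Rightarrow> 'a \<Rightarrow> ereal" where
  "gen_psi l \<mu> \<rho> x y =
     (if 0 < pmf \<rho> y \<and> 0 < pmf \<rho> x then
        ereal (pmf \<mu> y / pmf \<rho> y * pmf \<rho> x - pmf \<mu> x
          - 1 / l * (pmf \<mu> x powr (1 - l) * pmf \<rho> x powr l * (pmf \<mu> y / pmf \<rho> y) powr l
                      - pmf \<mu> x))
      else if pmf \<rho> y = 0 \<and> 0 < pmf \<rho> x \<and> 0 < pmf \<mu> y then \<infinity>
      else 0)"

text \<open>
  The sums are unconditional sums in \<^typ>\<open>ereal\<close>, where \<open>0 * \<infinity> = 0\<close>.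
  All values are kept in \<^typ>\<open>ereal\<close> rather than \<^typ>\<open>ennreal\<close>, so
  that non-negativity is not imposed by the type.
\<close>

definition gen_fisher :: "('a::countable \<Rightarrow> 'a \<Rightarrow> real) \<Rightarrow> real \<Rightarrow> 'a pmf \<Rightarrow> 'a pmf \<Rightarrow> ereal" where
  "gen_fisher L l \<mu> \<rho> = (\<Sum>\<^sub>\<infinity>(x, y)\<in>UNIV. ereal (L x y) * gen_psi l \<mu> \<rho> x y)"

text \<open>Meaningful for strictly positive \<open>\<mu>\<close> and \<open>\<rho>\<close> only.\<close>

definition fisher :: "('a::countable \<Rightarrow> 'a \<Rightarrow> real) \<Rightarrow> 'a pmf \<Rightarrow> 'a pmf \<Rightarrow> ereal" where
  "fisher L \<mu> \<rho> =
     (let v = (\<lambda>x. pmf \<mu> x / pmf \<rho> x) in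
       \<Sum>\<^sub>\<infinity>(x, y)\<in>UNIV. ereal (pmf \<rho> x * L x y * (v y - v x - v x * ln (v y / v x))))"

definition lower_semicontinuous :: "'b topology \<Rightarrow> ('b \<Rightarrow> ereal) \<Rightarrow> bool" where
  "lower_semicontinuous T f \<longleftrightarrow> (\<forall>c. openin T {z \<in> topspace T. c < f z})"

definition adjacent :: "('a \<Rightarrow> 'a \<Rightarrow> real) \<Rightarrow> 'a \<Rightarrow> 'a \<Rightarrow> bool" where
  "adjacent L x y \<longleftrightarrow> x \<noteq> y \<and> (0 < L x y \<or> 0 < L y x)"

text \<open>Vertex sets of the connected components of the subgraph induced on \<open>S\<close>.\<close>

definition connected_comps :: "('a \<Rightarrow> 'a \<Rightarrow> real) \<Rightarrow> 'a set \<Rightarrow> 'a set set" where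
  "connected_comps L S =
     S // {(x, y). x \<in> S \<and> y \<in> S \<and> (\<lambda>u v. u \<in> S \<and> v \<in> S \<and> adjacent L u v)\<^sup>*\<^sup>* x y}"

definition gamma_converges ::
  "'b topology \<Rightarrow> (real \<Rightarrow> 'b \<Rightarrow> 'b \<Rightarrow> ereal) \<Rightarrow> ('b \<Rightarrow> 'b \<Rightarrow> ereal) \<Rightarrow> bool" where
  "gamma_converges T F G \<longleftrightarrow>
     (\<forall>m r \<mu> \<rho>.
        (\<forall>l\<in>{0<..<1}. m l \<in> topspace T \<and> r l \<in> topspace T) \<and>
        limitin T m \<mu> (at_right 0) \<and> limitin T r \<rho> (at_right 0) \<longrightarrow>
        G \<mu> \<rho> \<le> Liminf (at_right 0) (\<lambda>l. F l (m l) (r l))) \<and>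
     (\<forall>\<mu>\<in>topspace T. \<forall>\<rho>\<in>topspace T. \<exists>m r.
        (\<forall>l\<in>{0<..<1}. m l \<in> topspace T \<and> r l \<in> topspace T) \<and>
        limitin T m \<mu> (at_right 0) \<and> limitin T r \<rho> (at_right 0) \<and>
        Limsup (at_right 0) (\<lambda>l. F l (m l) (r l)) \<le> G \<mu> \<rho>)"

end

theory Submission imports Defs begin

text \<open>
  Put \<open>a = \<mu>(x)\<close> and \<open>w = \<rho>(x) \<mu>(y) / \<rho>(y)\<close>. Where \<open>\<rho>(x)\<close> and \<open>\<rho>(y)\<close> are positive, the
  summand \<open>\<psi>\<^sub>\<lambda>(x,y)\<close> is \<open>1/\<lambda>\<close> times the amount by which the weighted geometric mean
  \<open>a\<^sup>1\<^sup>-\<^sup>\<lambda> w\<^sup>\<lambda>\<close> falls short of the arithmetic mean \<open>(1 - \<lambda>) a + \<lambda> w\<close>. All claims are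
  statements about this function of \<open>(a,w)\<close>, here called \<open>young_gap\<close>, passed on to the sum.

  Non-negativity is the inequality of the means. If the sum of non-negative terms is zero, then
  each term is zero, and equality of the means forces \<open>a = w\<close>, that is
  \<open>\<mu>(x)/\<rho>(x) = \<mu>(y)/\<rho>(y)\<close> along every edge inside the support of \<open>\<rho>\<close>
  (\<open>gen_fisher_0_ratio_eq\<close>). Walking along paths gives a constant ratio on each component; for
  positive \<open>\<rho>\<close> irreducibility makes it constant everywhere, and total mass one makes it \<open>1\<close>.

  Both lower semicontinuity and the lower bound of the Gamma limit reduce to single summands by a
  Fatou lemma for unconditional sums along an arbitrary filter (\<open>infsum_le_Liminf_ereal\<close>), so that
  only pointwise convergence of the measures is used. A summand is continuous where \<open>\<rho>(x)\<close> and
  \<open>\<rho>(y)\<close> are positive. The delicate point is \<open>\<rho>(y) \<rightarrow> 0\<close> with \<open>\<rho>(x)\<close> and \<open>\<mu>(y)\<close> staying positive,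
  where \<open>w \<rightarrow> \<infinity>\<close>; the bound \<open>w/2 - K a\<close> of \<open>young_gap_coercive\<close> shows that the summand
  tends to infinity. As \<open>\<lambda> \<rightarrow> 0\<close> the gap tends to \<open>w - a - a ln(w/a)\<close>, the summand of the
  classical Fisher information.

  For the upper bound constant families suffice, because the inequality \<open>1 + h \<le> exp h\<close> shows
  that each summand is at most its limit as \<open>\<lambda> \<rightarrow> 0\<close> (\<open>young_gap_le_log_gap\<close>).
\<close>

section \<open>The gap in Young's inequality\<close>

text \<open>
  Arranged as in the summand of the generalised Fisher information, with
  \<open>w = \<rho>(x) \<mu>(y) / \<rho>(y)\<close>; its relation to the two means is \<open>young_gap_eq\<close> below.
\<close>
definition young_gap :: "real \<Rightarrow> real \<Rightarrow> real \<Rightarrow> real" where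
  "young_gap l a w = w - a - (a powr (1 - l) * w powr l - a) / l"

definition log_gap :: "real \<Rightarrow> real \<Rightarrow> real" where
  "log_gap a w = w - a - a * ln (w / a)"

lemma weighted_am_gm:
  fixes a b l :: real
  assumes "0 < l" "l < 1" "0 \<le> a" "0 \<le> b"
  shows "a powr (1 - l) * b powr l \<le> (1 - l) * a + l * b"
proof (cases "a = 0 \<or> b = 0")
  case False
  then show ?thesis
    using Youngs_inequality_0[of "1 - l" l a b] assms by auto
qed (use assms in auto)

text \<open>
  After dividing by the common value \<open>m\<close> of the two means, the tangent line inequality
  \<open>ln t \<le> t - 1\<close> at \<open>t = a/m\<close> and \<open>t = b/m\<close> holds with equality on average, hence in both
  places, and it is strict unless \<open>t = 1\<close>.
\<close>
lemma weighted_am_gm_eqD: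
  fixes a b l :: real
  assumes l: "0 < l" "l < 1" and nonneg: "0 \<le> a" "0 \<le> b"
    and eq: "a powr (1 - l) * b powr l = (1 - l) * a + l * b"
  shows "a = b"
proof (cases "a = 0 \<or> b = 0")
  case True
  then show ?thesis using eq l by auto
next
  case False
  then have pos: "0 < a" "0 < b" using nonneg by auto
  define m where "m = (1 - l) * a + l * b"
  have m: "0 < m" unfolding m_def using l pos by (simp add: add_pos_pos)
  have "ln m = (1 - l) * ln a + l * ln b"
    unfolding m_def eq[symmetric] using pos by (simp add: ln_mult ln_powr)
  then have sum_ln: "(1 - l) * ln (a / m) + l * ln (b / m) = 0"
    using pos m by (simp add: ln_div algebra_simps)
  have sum_lin: "(1 - l) * (a / m - 1) + l * (b / m - 1) = 0"
    using m by (simp add: m_def field_simps)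
  have le: "ln (a / m) \<le> a / m - 1" "ln (b / m) \<le> b / m - 1"
    using pos m by (auto intro: ln_le_minus_one)
  have "(1 - l) * (a / m - 1 - ln (a / m)) + l * (b / m - 1 - ln (b / m)) = 0"
    using sum_ln sum_lin by (simp add: algebra_simps)
  moreover have "0 \<le> (1 - l) * (a / m - 1 - ln (a / m))" "0 \<le> l * (b / m - 1 - ln (b / m))"
    using l le by simp_all
  ultimately have "(1 - l) * (a / m - 1 - ln (a / m)) = 0" "l * (b / m - 1 - ln (b / m)) = 0"
    by linarith+
  then have "ln (a / m) = a / m - 1" "ln (b / m) = b / m - 1" using l by auto
  then have "a / m = 1" "b / m = 1"
    using pos m ln_eq_minus_one[of "a / m"] ln_eq_minus_one[of "b / m"] by simp_all
  then show ?thesis using m by simp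
qed

lemma young_gap_eq:
  assumes "0 < l"
  shows "l * young_gap l a w = (1 - l) * a + l * w - a powr (1 - l) * w powr l"
  using assms by (simp add: young_gap_def field_simps)

lemma young_gap_nonneg:
  assumes "0 < l" "l < 1" "0 \<le> a" "0 \<le> w"
  shows "0 \<le> young_gap l a w"
proof -
  have "0 \<le> l * young_gap l a w"
    using weighted_am_gm[OF assms] young_gap_eq[OF assms(1)] by simp
  then show ?thesis using assms(1) by (simp add: zero_le_mult_iff)
qed

lemma young_gap_eq_0D:
  assumes "0 < l" "l < 1" "0 \<le> a" "0 \<le> w" "young_gap l a w = 0"
  shows "a = w"
  using weighted_am_gm_eqD[OF assms(1-4)] young_gap_eq[OF assms(1), of a w] assms(5) by simp

lemma young_gap_same:
  assumes "0 \<le> a"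
  shows "young_gap l a a = 0"
  using assms by (cases "a = 0") (simp_all add: young_gap_def flip: powr_add)

text \<open>
  The gap grows linearly in \<open>w\<close>, which yields the value \<open>\<infinity>\<close> of the summand when
  \<open>\<rho>(y) \<rightarrow> 0\<close>. The geometric mean of \<open>a\<close> and \<open>w\<close> is also that of \<open>t\<^sup>l a\<close> and \<open>t\<^sup>l\<^sup>-\<^sup>1 w\<close> for any
  \<open>t > 0\<close>, so it is at most \<open>(1 - l) t\<^sup>l a + l t\<^sup>l\<^sup>-\<^sup>1 w\<close>; a large \<open>t\<close> makes the weight of \<open>w\<close>
  smaller than the weight \<open>l\<close> that it has in the arithmetic mean.
\<close>
lemma young_gap_coercive:
  assumes l: "0 < l" "l < 1"
  shows "\<exists>K. \<forall>a\<ge>0. \<forall>w\<ge>0. w / 2 - K * a \<le> young_gap l a w"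
proof -
  \<comment> \<open>This \<open>t\<close> halves the weight of \<open>w\<close>.\<close>
  define t :: real where "t = 2 powr (1 / (1 - l))"
  have t: "0 < t" by (simp add: t_def)
  have t_half: "t powr (l - 1) = 1 / 2"
  proof -
    have "1 / (1 - l) * (l - 1) = -1" using l by (simp add: field_simps)
    then show ?thesis by (simp add: t_def powr_powr powr_minus)
  qed
  define K where "K = 1 + ((1 - l) * t powr l - 1) / l"
  have "w / 2 - K * a \<le> young_gap l a w"
    if "0 \<le> a" "0 \<le> w" for a w
  proof -
    have "l * (1 - l) + (l - 1) * l = 0" by (simp add: algebra_simps)
    then have cancel: "(t powr l) powr (1 - l) * (t powr (l - 1)) powr l = 1"
      using t by (simp add: powr_powr flip: powr_add)
    have "a powr (1 - l) * w powr l
        = (t powr l) powr (1 - l) * (t powr (l - 1)) powr l * (a powr (1 - l) * w powr l)"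
      unfolding cancel by simp
    also have "\<dots> = (t powr l * a) powr (1 - l) * (t powr (l - 1) * w) powr l"
      using that by (simp add: powr_mult)
    also have "\<dots> \<le> (1 - l) * (t powr l * a) + l * (t powr (l - 1) * w)"
      using that l by (intro weighted_am_gm) auto
    finally have "a powr (1 - l) * w powr l \<le> (1 - l) * (t powr l * a) + l * (w / 2)"
      unfolding t_half by simp
    moreover have "l * K = l + ((1 - l) * t powr l - 1)"
      using l by (simp add: K_def distrib_left)
    then have "l * (w / 2 - K * a) = l * (w / 2) - (l + ((1 - l) * t powr l - 1)) * a"
      by (metis mult.assoc right_diff_distrib)
    ultimately have "l * (w / 2 - K * a) \<le> l * young_gap l a w"
      unfolding young_gap_eq[OF l(1)] by (simp add: algebra_simps)
    then show ?thesis using l by simp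
  qed
  then show ?thesis by blast
qed

lemma powr_mean_eq_exp:
  fixes a w l :: real
  assumes "0 < a" "0 < w"
  shows "a powr (1 - l) * w powr l = a * exp (l * ln (w / a))"
proof -
  have "a powr (1 - l) * w powr l = exp (ln a + l * ln (w / a))"
    using assms by (simp add: powr_def ln_div algebra_simps mult_exp_exp)
  then show ?thesis using assms by (simp add: exp_add)
qed

text \<open>
  The difference quotient \<open>((w/a)\<^sup>l - 1)/l\<close> of an exponential lies above its derivative
  \<open>ln (w/a)\<close> at zero. This makes constant families recovery sequences.
\<close>
lemma young_gap_le_log_gap:
  assumes "0 < l" "0 < a" "0 < w"
  shows "young_gap l a w \<le> log_gap a w"
proof -
  have "a * (1 + l * ln (w / a)) \<le> a * exp (l * ln (w / a))"
    using assms by (intro mult_left_mono exp_ge_add_one_self) auto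
  then have "l * (a * ln (w / a)) \<le> a powr (1 - l) * w powr l - a"
    using assms by (simp add: powr_mean_eq_exp distrib_left mult.left_commute)
  then have "a * ln (w / a) \<le> (a powr (1 - l) * w powr l - a) / l"
    using assms by (simp add: pos_le_divide_eq mult.commute)
  then show ?thesis
    by (simp add: young_gap_def log_gap_def)
qed

text \<open>
  The exponent may vary with \<open>l\<close>, as needed for measures that depend on the parameter. It may
  also vanish, so the quotient is written as \<open>t l * \<phi> (l * t l)\<close> with \<open>\<phi>\<close> the continuous
  extension of \<open>(exp h - 1) / h\<close>.
\<close>
lemma exp_quotient_tendsto:
  fixes t :: "real \<Rightarrow> real"
  assumes "(t \<longlongrightarrow> t0) (at_right 0)"
  shows "((\<lambda>l. (exp (l * t l) - 1) / l) \<longlongrightarrow> t0) (at_right 0)"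
proof -
  define \<phi> :: "real \<Rightarrow> real" where "\<phi> h = (if h = 0 then 1 else (exp h - 1) / h)" for h
  have "((\<lambda>h::real. (exp (0 + h) - exp 0) / h) \<longlongrightarrow> exp 0) (at 0)"
    using DERIV_exp[of 0] unfolding DERIV_def .
  then have "(\<phi> \<longlongrightarrow> \<phi> 0) (at 0)"
    unfolding \<phi>_def by (subst tendsto_cong[where g = "\<lambda>h. (exp h - 1) / h"])
      (auto simp: eventually_at intro: exI[of _ 1])
  then have cont: "isCont \<phi> 0" by (simp add: isCont_def)
  have "((\<lambda>l. l * t l) \<longlongrightarrow> 0 * t0) (at_right 0)"
    by (intro tendsto_intros assms)
  then have "((\<lambda>l. \<phi> (l * t l)) \<longlongrightarrow> \<phi> 0) (at_right 0)"
    using isCont_tendsto_compose[OF cont] by simp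
  then have "((\<lambda>l. t l * \<phi> (l * t l)) \<longlongrightarrow> t0 * 1) (at_right 0)"
    using assms by (intro tendsto_intros) (simp_all add: \<phi>_def)
  moreover have "\<forall>\<^sub>F l in at_right 0. t l * \<phi> (l * t l) = (exp (l * t l) - 1) / l"
    by (rule eventually_at_rightI[of 0 1]) (auto simp: \<phi>_def)
  ultimately show ?thesis
    by (auto intro: Lim_transform_eventually)
qed

lemma young_gap_tendsto_log_gap:
  assumes a: "(a \<longlongrightarrow> a0) (at_right 0)" and w: "(w \<longlongrightarrow> w0) (at_right 0)"
    and pos: "0 < a0" "0 < w0"
  shows "((\<lambda>l. young_gap l (a l) (w l)) \<longlongrightarrow> log_gap a0 w0) (at_right 0)"
proof -
  have "((\<lambda>l. w l - a l - a l * ((exp (l * ln (w l / a l)) - 1) / l))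
      \<longlongrightarrow> w0 - a0 - a0 * ln (w0 / a0)) (at_right 0)"
    using pos by (intro tendsto_diff tendsto_mult exp_quotient_tendsto tendsto_ln tendsto_divide a w) auto
  moreover have "\<forall>\<^sub>F l in at_right 0.
      w l - a l - a l * ((exp (l * ln (w l / a l)) - 1) / l) = young_gap l (a l) (w l)"
    using order_tendstoD(1)[OF a pos(1)] order_tendstoD(1)[OF w pos(2)]
  proof eventually_elim
    case (elim l)
    then show ?case by (simp add: young_gap_def powr_mean_eq_exp right_diff_distrib)
  qed
  ultimately show ?thesis
    unfolding log_gap_def by (rule Lim_transform_eventually)
qed

section \<open>Unconditional sums of non-negative extended reals\<close>

lemma ereal_less_add_split:
  fixes a b y :: ereal
  assumes "y < a + b" "0 \<le> a" "0 \<le> b"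
  shows "\<exists>c<a. \<exists>d<b. y \<le> c + d"
proof (cases y)
  case PInf
  then show ?thesis using assms by auto
next
  case MInf
  then show ?thesis using assms by (intro exI[of _ "-\<infinity>"] conjI) auto
next
  case y: (real r)
  show ?thesis
  proof (cases a; cases b)
    fix p q assume ab: "a = ereal p" "b = ereal q"
    show ?thesis using assms y ab
      by (intro exI[of _ "ereal (p - (p + q - r) / 2)"] exI[of _ "ereal (q - (p + q - r) / 2)"] conjI)
        (auto simp: field_simps)
  next
    fix p assume ab: "a = ereal p" "b = \<infinity>"
    show ?thesis using y ab
      by (intro exI[of _ "ereal (p - 1)"] exI[of _ "ereal (r - p + 1)"] conjI) auto
  next
    fix q assume ab: "a = \<infinity>" "b = ereal q"
    show ?thesis using y ab
      by (intro exI[of _ "ereal (q - 1)"] exI[of _ "ereal (r - q + 1)"] conjI) auto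
  next
    assume ab: "a = \<infinity>" "b = \<infinity>"
    show ?thesis using y ab
      by (intro exI[of _ "ereal r"] exI[of _ "ereal 0"] conjI) auto
  qed (use assms in auto)
qed

text \<open>The signs exclude sums of the form \<open>\<infinity> + (-\<infinity>)\<close>.\<close>
lemma Liminf_add_ge_ereal:
  fixes f g :: "'b \<Rightarrow> ereal"
  assumes "a \<le> Liminf F f" "b \<le> Liminf F g" "0 \<le> a" "0 \<le> b"
  shows "a + b \<le> Liminf F (\<lambda>z. f z + g z)"
  unfolding le_Liminf_iff
proof (intro allI impI)
  fix y assume "y < a + b"
  then obtain c d where "c < a" "d < b" and le: "y \<le> c + d"
    using ereal_less_add_split assms(3,4) by blast
  then have "\<forall>\<^sub>F z in F. c < f z" "\<forall>\<^sub>F z in F. d < g z"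
    using assms(1,2) by (auto simp: le_Liminf_iff)
  then show "\<forall>\<^sub>F z in F. y < f z + g z"
    by eventually_elim (use le ereal_add_strict_mono2 order.strict_trans1 in blast)
qed

lemma sum_le_Liminf_ereal:
  fixes f :: "'i \<Rightarrow> ereal" and g :: "'b \<Rightarrow> 'i \<Rightarrow> ereal"
  assumes "finite I" "\<And>i. i \<in> I \<Longrightarrow> f i \<le> Liminf F (\<lambda>z. g z i)" "\<And>i. 0 \<le> f i"
  shows "sum f I \<le> Liminf F (\<lambda>z. sum (g z) I)"
  using assms
proof (induction I rule: finite_induct)
  case empty
  then show ?case by (cases "F = bot") (auto simp: Liminf_const top_ereal_def)
next
  case (insert i I)
  then have "f i + sum f I \<le> Liminf F (\<lambda>z. g z i + sum (g z) I)"
    by (intro Liminf_add_ge_ereal sum_nonneg) auto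
  then show ?case using insert by simp
qed

lemma sum_le_infsum_ereal:
  fixes f :: "'i \<Rightarrow> ereal"
  assumes "finite I" "\<And>i. 0 \<le> f i"
  shows "sum f I \<le> infsum f UNIV"
  using assms by (subst nonneg_infsum_complete) (auto intro!: SUP_upper)

text \<open>
  Fatou's lemma for unconditional sums. The sum is the supremum of its finite partial sums, for
  which the claim is superadditivity of the lower limit; this works along every filter, not
  only along sequences.
\<close>
lemma infsum_le_Liminf_ereal:
  fixes f :: "'i \<Rightarrow> ereal" and g :: "'b \<Rightarrow> 'i \<Rightarrow> ereal"
  assumes term_le: "\<And>i. f i \<le> Liminf F (\<lambda>z. g z i)" and f: "\<And>i. 0 \<le> f i"
    and g: "\<forall>\<^sub>F z in F. \<forall>i. 0 \<le> g z i"
  shows "infsum f UNIV \<le> Liminf F (\<lambda>z. infsum (g z) UNIV)"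
proof -
  have "sum f I \<le> Liminf F (\<lambda>z. infsum (g z) UNIV)" if "finite I" for I
  proof -
    have "sum f I \<le> Liminf F (\<lambda>z. sum (g z) I)"
      using that term_le f by (rule sum_le_Liminf_ereal)
    also have "\<dots> \<le> Liminf F (\<lambda>z. infsum (g z) UNIV)"
      by (rule Liminf_mono, use g in eventually_elim) (use that sum_le_infsum_ereal in blast)
    finally show ?thesis .
  qed
  then show ?thesis
    using f by (subst nonneg_infsum_complete) (auto intro!: SUP_least)
qed

lemma infsum_ereal_eq_0D:
  fixes f :: "'i \<Rightarrow> ereal"
  assumes "infsum f UNIV = 0" "\<And>i. 0 \<le> f i"
  shows "f i = 0"
  using sum_le_infsum_ereal[of "{i}" f] assms by (simp add: antisym)

section \<open>The summands of the Fisher information\<close>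

lemma gen_psi_eq_young_gap:
  assumes "0 < pmf \<rho> x" "0 < pmf \<rho> y"
  shows "gen_psi l \<mu> \<rho> x y = ereal (young_gap l (pmf \<mu> x) (pmf \<rho> x * (pmf \<mu> y / pmf \<rho> y)))"
proof -
  have "(pmf \<rho> x * (pmf \<mu> y / pmf \<rho> y)) powr l = pmf \<rho> x powr l * (pmf \<mu> y / pmf \<rho> y) powr l"
    by (rule powr_mult)
  then show ?thesis using assms by (simp add: gen_psi_def young_gap_def mult.assoc mult.commute)
qed

lemma gen_psi_nonneg:
  assumes "0 < l" "l < 1"
  shows "0 \<le> gen_psi l \<mu> \<rho> x y"
proof (cases "0 < pmf \<rho> x \<and> 0 < pmf \<rho> y")
  case True
  then show ?thesis using assms by (simp add: gen_psi_eq_young_gap young_gap_nonneg)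
qed (auto simp: gen_psi_def)

lemma gen_psi_diag: "gen_psi l \<mu> \<rho> x x = 0"
proof (cases "0 < pmf \<rho> x")
  case True
  then show ?thesis by (simp add: gen_psi_eq_young_gap young_gap_same zero_ereal_def)
qed (auto simp: gen_psi_def)

text \<open>The diagonal entries of \<open>L\<close> may be negative, but they are multiplied by zero.\<close>
lemma gen_fisher_summand_nonneg:
  assumes "generator L" "0 < l" "l < 1"
  shows "0 \<le> ereal (L x y) * gen_psi l \<mu> \<rho> x y"
proof (cases "x = y")
  case False
  then show ?thesis using assms by (simp add: generator_def gen_psi_nonneg)
qed (simp add: gen_psi_diag)

text \<open>
  Stated for arbitrary filters so that the neighbourhood filter of the \<open>\<ell>\<^sup>1\<close> product topology
  can be used. Where the summand is zero at the limit, its sign is enough.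
\<close>
lemma gen_psi_lower_semicontinuous:
  assumes l: "0 < l" "l < 1"
    and m: "\<And>x. ((\<lambda>z. pmf (m z) x) \<longlongrightarrow> pmf \<mu> x) F"
    and r: "\<And>x. ((\<lambda>z. pmf (r z) x) \<longlongrightarrow> pmf \<rho> x) F"
  shows "gen_psi l \<mu> \<rho> x y \<le> Liminf F (\<lambda>z. gen_psi l (m z) (r z) x y)"
proof -
  consider (pos) "0 < pmf \<rho> x" "0 < pmf \<rho> y"
    | (inf) "0 < pmf \<rho> x" "pmf \<rho> y = 0" "0 < pmf \<mu> y"
    | (zero) "gen_psi l \<mu> \<rho> x y = 0"
    by (cases "0 < pmf \<rho> x \<and> 0 < pmf \<rho> y"; cases "pmf \<rho> y = 0 \<and> 0 < pmf \<rho> x \<and> 0 < pmf \<mu> y")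
      (auto simp: gen_psi_def)
  then show ?thesis
  proof cases
    case zero
    then show ?thesis
      by (simp only:) (intro Liminf_bounded always_eventually allI gen_psi_nonneg l)
  next
    case pos
    have "((\<lambda>z. young_gap l (pmf (m z) x) (pmf (r z) x * (pmf (m z) y / pmf (r z) y)))
        \<longlongrightarrow> young_gap l (pmf \<mu> x) (pmf \<rho> x * (pmf \<mu> y / pmf \<rho> y))) F"
      unfolding young_gap_def
      by (intro tendsto_intros tendsto_powr' m r) (use pos l in \<open>auto simp: pmf_nonneg\<close>)
    then have lim: "((\<lambda>z. ereal (young_gap l (pmf (m z) x) (pmf (r z) x * (pmf (m z) y / pmf (r z) y))))
        \<longlongrightarrow> gen_psi l \<mu> \<rho> x y) F"
      using pos by (simp add: gen_psi_eq_young_gap)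
    show ?thesis
      unfolding le_Liminf_iff
    proof (intro allI impI)
      fix c assume "c < gen_psi l \<mu> \<rho> x y"
      from order_tendstoD(1)[OF lim this] order_tendstoD(1)[OF r pos(1)] order_tendstoD(1)[OF r pos(2)]
      show "\<forall>\<^sub>F z in F. c < gen_psi l (m z) (r z) x y"
        by eventually_elim (simp add: gen_psi_eq_young_gap)
    qed
  next
    case inf
    obtain K where K: "\<And>a w. 0 \<le> a \<Longrightarrow> 0 \<le> w \<Longrightarrow> w / 2 - K * a \<le> young_gap l a w"
      using young_gap_coercive[OF l] by blast
    have "\<forall>\<^sub>F z in F. ereal c < gen_psi l (m z) (r z) x y" for c
    proof -
      \<comment> \<open>The inequality \<open>c < w/2 - K a\<close> multiplied by \<open>2 \<rho>(y)\<close>, which has a finite limit.\<close>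
      have "((\<lambda>z. pmf (r z) x * pmf (m z) y - 2 * pmf (r z) y * (c + K * pmf (m z) x))
          \<longlongrightarrow> pmf \<rho> x * pmf \<mu> y - 2 * pmf \<rho> y * (c + K * pmf \<mu> x)) F"
        by (intro tendsto_intros m r)
      then have "\<forall>\<^sub>F z in F. 0 < pmf (r z) x * pmf (m z) y - 2 * pmf (r z) y * (c + K * pmf (m z) x)"
        by (rule order_tendstoD) (use inf in simp)
      then show ?thesis
        using order_tendstoD(1)[OF r inf(1)] order_tendstoD(1)[OF m inf(3)]
      proof eventually_elim
        case (elim z)
        show ?case
        proof (cases "pmf (r z) y = 0")
          case True
          then show ?thesis using elim by (simp add: gen_psi_def)
        next
          case False
          then have s: "0 < pmf (r z) y" by (simp add: order_less_le)
          then have "c + K * pmf (m z) x < pmf (r z) x * (pmf (m z) y / pmf (r z) y) / 2"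
            using elim(1) by (simp add: field_simps)
          also have "\<dots> \<le> young_gap l (pmf (m z) x) (pmf (r z) x * (pmf (m z) y / pmf (r z) y))
              + K * pmf (m z) x"
            using K[of "pmf (m z) x" "pmf (r z) x * (pmf (m z) y / pmf (r z) y)"] by simp
          finally show ?thesis using elim(2) s by (simp add: gen_psi_eq_young_gap)
        qed
      qed
    qed
    then have "\<forall>\<^sub>F z in F. c < gen_psi l (m z) (r z) x y" if c: "c < \<infinity>" for c
    proof -
      obtain d where "c < ereal d" using ereal_dense2[OF c] by blast
      with \<open>\<And>c. \<forall>\<^sub>F z in F. ereal c < gen_psi l (m z) (r z) x y\<close>[of d] show ?thesis
        by (auto elim!: eventually_mono)
    qed
    then show ?thesis
      unfolding le_Liminf_iff using inf by (simp add: gen_psi_def)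
  qed
qed

section \<open>Convergence of probability measures\<close>

lemma topspace_l1_topology [simp]: "topspace l1_topology = UNIV"
  by (simp add: l1_topology_def Metric_space.topspace_mtopology Metric_space_l1_dist)

lemma abs_pmf_diff_le_l1_dist: "\<bar>pmf \<mu> x - pmf \<nu> x\<bar> \<le> l1_dist \<mu> \<nu>"
  using finite_sum_le_infsum[OF summable_on_abs_pmf_diff[of \<mu> \<nu>], of "{x}"]
  by (simp add: l1_dist_def)

lemma limitin_l1_topology_pmf:
  assumes "limitin l1_topology m \<mu> F"
  shows "((\<lambda>z. pmf (m z) x) \<longlongrightarrow> pmf \<mu> x) F"
proof (rule tendstoI)
  fix e :: real assume "0 < e"
  then have "\<forall>\<^sub>F z in F. l1_dist (m z) \<mu> < e"
    using assms by (simp add: l1_topology_def Metric_space.limitin_metric[OF Metric_space_l1_dist])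
  then show "\<forall>\<^sub>F z in F. dist (pmf (m z) x) (pmf \<mu> x) < e"
    by eventually_elim (simp add: dist_real_def order.strict_trans1[OF abs_pmf_diff_le_l1_dist])
qed

lemma limitin_nhdsin:
  assumes "z \<in> topspace T"
  shows "limitin T (\<lambda>w. w) z (nhdsin T z)"
  using assms by (auto simp: limitin_def eventually_nhdsin)

lemma lower_semicontinuousI:
  assumes "\<And>z. z \<in> topspace T \<Longrightarrow> f z \<le> Liminf (nhdsin T z) f"
  shows "lower_semicontinuous T f"
  unfolding lower_semicontinuous_def
proof
  fix c
  show "openin T {z \<in> topspace T. c < f z}"
  proof (subst openin_subopen, safe)
    fix z assume z: "z \<in> topspace T" "c < f z"
    then have "\<forall>\<^sub>F w in nhdsin T z. c < f w"
      using assms le_Liminf_iff by blast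
    then obtain S where "openin T S" "z \<in> S" "\<forall>w\<in>S. c < f w"
      using z by (auto simp: eventually_nhdsin)
    then show "\<exists>S. openin T S \<and> z \<in> S \<and> S \<subseteq> {z \<in> topspace T. c < f z}"
      using openin_subset by blast
  qed
qed

section \<open>Properties of the generalised Fisher information\<close>

lemma gen_fisher_nonneg:
  assumes "generator L" "0 < l" "l < 1"
  shows "0 \<le> gen_fisher L l \<mu> \<rho>"
  unfolding gen_fisher_def
  using gen_fisher_summand_nonneg[OF assms] by (intro infsum_nonneg) auto

lemma ereal_mult_le_Liminf:
  fixes f :: "'b \<Rightarrow> ereal"
  assumes "0 < c" "a \<le> Liminf F f"
  shows "ereal c * a \<le> Liminf F (\<lambda>z. ereal c * f z)"
  unfolding le_Liminf_iff
proof (intro allI impI)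
  fix y assume "y < ereal c * a"
  then have "y / ereal c < a"
    using assms(1) by (simp add: ereal_divide_less_iff mult.commute)
  then have "\<forall>\<^sub>F z in F. y / ereal c < f z"
    using assms(2) by (simp add: le_Liminf_iff)
  then show "\<forall>\<^sub>F z in F. y < ereal c * f z"
    by eventually_elim (use assms(1) in \<open>simp add: ereal_divide_less_iff mult.commute\<close>)
qed

lemma gen_fisher_lower_semicontinuous:
  assumes L: "generator L" and l: "0 < l" "l < 1"
  shows "lower_semicontinuous (prod_topology l1_topology l1_topology)
           (\<lambda>(\<mu>, \<rho>). gen_fisher L l \<mu> \<rho>)"
proof (rule lower_semicontinuousI, clarify)
  fix \<mu> \<rho> :: "'a pmf"
  let ?N = "nhdsin (prod_topology l1_topology l1_topology) (\<mu>, \<rho>)"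
  have lim: "limitin (prod_topology l1_topology l1_topology) (\<lambda>z. z) (\<mu>, \<rho>) ?N"
    by (rule limitin_nhdsin) simp
  have m: "((\<lambda>z. pmf (fst z) x) \<longlongrightarrow> pmf \<mu> x) ?N" for x
    using continuous_map_limit[OF continuous_map_fst lim]
    by (intro limitin_l1_topology_pmf) (simp add: comp_def)
  have r: "((\<lambda>z. pmf (snd z) x) \<longlongrightarrow> pmf \<rho> x) ?N" for x
    using continuous_map_limit[OF continuous_map_snd lim]
    by (intro limitin_l1_topology_pmf) (simp add: comp_def)
  have "(\<Sum>\<^sub>\<infinity>(x, y)\<in>UNIV. ereal (L x y) * gen_psi l \<mu> \<rho> x y)
      \<le> Liminf ?N (\<lambda>z. \<Sum>\<^sub>\<infinity>(x, y)\<in>UNIV. ereal (L x y) * gen_psi l (fst z) (snd z) x y)"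
  proof (rule infsum_le_Liminf_ereal, goal_cases)
    case (1 i)
    obtain x y where i: "i = (x, y)" by (cases i)
    show ?case
    proof (cases "x = y \<or> L x y = 0")
      case True
      then show ?thesis by (auto simp: i gen_psi_diag zero_ereal_def[symmetric] intro!: Liminf_bounded)
    next
      case False
      then have "0 < L x y" using L by (auto simp: generator_def order_less_le)
      then show ?thesis
        unfolding i prod.case
        by (intro ereal_mult_le_Liminf gen_psi_lower_semicontinuous l m r)
    qed
  qed (use gen_fisher_summand_nonneg[OF L l] in auto)
  then show "gen_fisher L l \<mu> \<rho> \<le> Liminf ?N (\<lambda>(\<mu>, \<rho>). gen_fisher L l \<mu> \<rho>)"
    by (simp add: gen_fisher_def case_prod_unfold)
qed

text \<open>Equality in the inequality of the means at a single edge.\<close>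
lemma gen_fisher_0_ratio_eq:
  assumes L: "generator L" and l: "0 < l" "l < 1"
    and zero: "gen_fisher L l \<mu> \<rho> = 0"
    and edge: "0 < L x y" and pos: "0 < pmf \<rho> x" "0 < pmf \<rho> y"
  shows "pmf \<mu> x / pmf \<rho> x = pmf \<mu> y / pmf \<rho> y"
proof -
  have "(case (x, y) of (x, y) \<Rightarrow> ereal (L x y) * gen_psi l \<mu> \<rho> x y) = 0"
    by (rule infsum_ereal_eq_0D[OF zero[unfolded gen_fisher_def]])
      (auto intro: gen_fisher_summand_nonneg[OF L l])
  then have "gen_psi l \<mu> \<rho> x y = 0" using edge by auto
  then have "young_gap l (pmf \<mu> x) (pmf \<rho> x * (pmf \<mu> y / pmf \<rho> y)) = 0"
    using pos by (simp add: gen_psi_eq_young_gap zero_ereal_def)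
  then have "pmf \<mu> x = pmf \<rho> x * (pmf \<mu> y / pmf \<rho> y)"
    by (rule young_gap_eq_0D[OF l, rotated 2]) simp_all
  then show ?thesis using pos by (simp add: field_simps)
qed

lemma gen_fisher_0_component:
  assumes L: "generator L" and l: "0 < l" "l < 1"
    and zero: "gen_fisher L l \<mu> \<rho> = 0"
    and C: "C \<in> connected_comps L (set_pmf \<rho>)"
  shows "\<exists>c. \<forall>x\<in>C. pmf \<mu> x = c * pmf \<rho> x"
proof -
  let ?E = "\<lambda>u v. u \<in> set_pmf \<rho> \<and> v \<in> set_pmf \<rho> \<and> adjacent L u v"
  obtain z where C_eq: "C = {x. z \<in> set_pmf \<rho> \<and> x \<in> set_pmf \<rho> \<and> ?E\<^sup>*\<^sup>* z x}"
    using C unfolding connected_comps_def quotient_def by auto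
  have "pmf \<mu> x = pmf \<mu> z / pmf \<rho> z * pmf \<rho> x" if "x \<in> C" for x
  proof -
    from that have path: "?E\<^sup>*\<^sup>* z x" and x: "0 < pmf \<rho> x"
      by (auto simp: C_eq pmf_positive)
    from path have "pmf \<mu> x / pmf \<rho> x = pmf \<mu> z / pmf \<rho> z"
    proof induction
      case (step u v)
      then show ?case
        using gen_fisher_0_ratio_eq[OF L l zero, of u v] gen_fisher_0_ratio_eq[OF L l zero, of v u]
        by (auto simp: adjacent_def pmf_positive)
    qed simp
    then show ?thesis using x by (simp add: field_simps)
  qed
  then show ?thesis by (intro exI ballI)
qed

lemma pmf_eq_of_proportional:
  assumes "\<And>x. pmf \<mu> x = c * pmf \<rho> x"
  shows "\<mu> = \<rho>"
proof -
  have "pmf \<mu> = (\<lambda>x. c * pmf \<rho> x)" using assms by (rule ext)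
  then have "infsetsum (pmf \<mu>) UNIV = infsetsum (\<lambda>x. c * pmf \<rho> x) UNIV" by (rule arg_cong)
  also have "\<dots> = c * infsetsum (pmf \<rho>) UNIV"
    by (rule infsetsum_cmult_right) (rule pmf_abs_summable)
  finally have "c = 1" by (simp add: infsetsum_pmf_eq_1)
  then show ?thesis by (intro pmf_eqI) (simp add: assms)
qed

lemma gen_fisher_0_positive:
  assumes L: "generator L" and l: "0 < l" "l < 1"
    and zero: "gen_fisher L l \<mu> \<rho> = 0" and pos: "\<rho> \<in> positive_pmfs"
  shows "\<mu> = \<rho>"
proof -
  have \<rho>: "0 < pmf \<rho> x" for x using pos by (simp add: positive_pmfs_def)
  \<comment> \<open>A base point; irreducibility provides a path from it to every other state.\<close>
  obtain z :: 'a where True by simp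
  have ratio: "pmf \<mu> x / pmf \<rho> x = pmf \<mu> z / pmf \<rho> z" for x
  proof (cases "x = z")
    case False
    then have "(\<lambda>u v. 0 < L u v)\<^sup>+\<^sup>+ z x" using L by (simp add: generator_def)
    then show ?thesis
    proof induction
      case (base u)
      then show ?case by (rule gen_fisher_0_ratio_eq[OF L l zero _ \<rho> \<rho>, symmetric])
    next
      case (step u v)
      from gen_fisher_0_ratio_eq[OF L l zero step.hyps(2) \<rho> \<rho>, symmetric] step.IH
      show ?case by (rule trans)
    qed
  qed simp
  have "pmf \<mu> x = pmf \<mu> z / pmf \<rho> z * pmf \<rho> x" for x
    unfolding ratio[of x, symmetric] using \<rho>[of x] by simp
  then show ?thesis by (rule pmf_eq_of_proportional)
qed

section \<open>The limit of vanishing parameter\<close>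

lemma fisher_eq_log_gap:
  assumes "\<mu> \<in> positive_pmfs" "\<rho> \<in> positive_pmfs"
  shows "fisher L \<mu> \<rho> =
    (\<Sum>\<^sub>\<infinity>(x, y)\<in>UNIV. ereal (L x y * log_gap (pmf \<mu> x) (pmf \<rho> x * (pmf \<mu> y / pmf \<rho> y))))"
proof -
  have "pmf \<rho> x * L x y * (pmf \<mu> y / pmf \<rho> y - pmf \<mu> x / pmf \<rho> x
          - pmf \<mu> x / pmf \<rho> x * ln (pmf \<mu> y / pmf \<rho> y / (pmf \<mu> x / pmf \<rho> x)))
      = L x y * log_gap (pmf \<mu> x) (pmf \<rho> x * (pmf \<mu> y / pmf \<rho> y))" for x y
  proof -
    have "0 < pmf \<rho> x" "0 < pmf \<rho> y" using assms by (auto simp: positive_pmfs_def)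
    then show ?thesis by (simp add: log_gap_def field_simps)
  qed
  then show ?thesis by (simp only: fisher_def Let_def)
qed

lemma gen_fisher_eq_young_gap:
  assumes "\<rho> \<in> positive_pmfs"
  shows "gen_fisher L l \<mu> \<rho> =
    (\<Sum>\<^sub>\<infinity>(x, y)\<in>UNIV. ereal (L x y * young_gap l (pmf \<mu> x) (pmf \<rho> x * (pmf \<mu> y / pmf \<rho> y))))"
  using assms by (simp add: gen_fisher_def gen_psi_eq_young_gap positive_pmfs_def)

text \<open>The logarithmic gap dominates any of the non-negative gaps, for instance the one at \<open>1/2\<close>.\<close>
lemma log_gap_nonneg:
  assumes "0 < a" "0 < w"
  shows "0 \<le> log_gap a w"
  using young_gap_le_log_gap[of "1/2" a w] young_gap_nonneg[of "1/2" a w] assms by simp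

lemma fisher_summand_nonneg:
  assumes L: "generator L" and "\<mu> \<in> positive_pmfs" "\<rho> \<in> positive_pmfs"
  shows "0 \<le> L x y * log_gap (pmf \<mu> x) (pmf \<rho> x * (pmf \<mu> y / pmf \<rho> y))"
proof -
  have pos: "0 < pmf \<mu> x" "0 < pmf \<mu> y" "0 < pmf \<rho> x" "0 < pmf \<rho> y"
    using assms by (auto simp: positive_pmfs_def)
  show ?thesis
  proof (cases "x = y")
    case True
    then show ?thesis using pos by (simp add: log_gap_def)
  next
    case False
    then show ?thesis using pos L by (simp add: generator_def log_gap_nonneg)
  qed
qed

lemma gen_fisher_le_fisher:
  assumes L: "generator L" and l: "0 < l" "l < 1"
    and \<mu>: "\<mu> \<in> positive_pmfs" and \<rho>: "\<rho> \<in> positive_pmfs"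
  shows "gen_fisher L l \<mu> \<rho> \<le> fisher L \<mu> \<rho>"
  unfolding gen_fisher_eq_young_gap[OF \<rho>] fisher_eq_log_gap[OF \<mu> \<rho>]
proof (rule infsum_mono; clarify?)
  have pos: "0 < pmf \<mu> x" "0 < pmf \<rho> x" for x
    using \<mu> \<rho> by (auto simp: positive_pmfs_def)
  show "ereal (L x y * young_gap l (pmf \<mu> x) (pmf \<rho> x * (pmf \<mu> y / pmf \<rho> y)))
      \<le> ereal (L x y * log_gap (pmf \<mu> x) (pmf \<rho> x * (pmf \<mu> y / pmf \<rho> y)))" for x y
  proof (cases "x = y")
    case True
    then show ?thesis using pos[of y] by (simp add: log_gap_def young_gap_same)
  next
    case False
    then show ?thesis
      using pos l L by (simp add: generator_def young_gap_le_log_gap mult_left_mono)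
  qed
  have "0 \<le> ereal (L x y * young_gap l (pmf \<mu> x) (pmf \<rho> x * (pmf \<mu> y / pmf \<rho> y)))" for x y
    using gen_fisher_summand_nonneg[OF L l, of x y \<mu> \<rho>] pos by (simp add: gen_psi_eq_young_gap)
  then show "(\<lambda>(x, y). ereal (L x y * young_gap l (pmf \<mu> x) (pmf \<rho> x * (pmf \<mu> y / pmf \<rho> y))))
      summable_on UNIV"
    by (intro nonneg_summable_on_complete) auto
  show "(\<lambda>(x, y). ereal (L x y * log_gap (pmf \<mu> x) (pmf \<rho> x * (pmf \<mu> y / pmf \<rho> y))))
      summable_on UNIV"
    using fisher_summand_nonneg[OF L \<mu> \<rho>] by (intro nonneg_summable_on_complete) auto
qed

lemma fisher_le_Liminf_gen_fisher:
  assumes L: "generator L"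
    and m: "limitin (subtopology l1_topology positive_pmfs) m \<mu> (at_right 0)"
    and r: "limitin (subtopology l1_topology positive_pmfs) r \<rho> (at_right 0)"
  shows "fisher L \<mu> \<rho> \<le> Liminf (at_right 0) (\<lambda>l. gen_fisher L l (m l) (r l))"
proof -
  have \<mu>: "\<mu> \<in> positive_pmfs" and \<rho>: "\<rho> \<in> positive_pmfs"
    and ev: "\<forall>\<^sub>F l in at_right 0. r l \<in> positive_pmfs"
    and lim: "\<And>x. ((\<lambda>l. pmf (m l) x) \<longlongrightarrow> pmf \<mu> x) (at_right 0)"
      "\<And>x. ((\<lambda>l. pmf (r l) x) \<longlongrightarrow> pmf \<rho> x) (at_right 0)"
    using m r by (auto simp: limitin_subtopology intro: limitin_l1_topology_pmf)
  have pos: "0 < pmf \<mu> x" "0 < pmf \<rho> x" for x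
    using \<mu> \<rho> by (auto simp: positive_pmfs_def)
  have ev_l: "\<forall>\<^sub>F l::real in at_right 0. 0 < l \<and> l < 1"
    by (rule eventually_at_rightI[of 0 1]) auto
  let ?g = "\<lambda>l (x, y). ereal (L x y *
    young_gap l (pmf (m l) x) (pmf (r l) x * (pmf (m l) y / pmf (r l) y)))"
  have "fisher L \<mu> \<rho> \<le> Liminf (at_right 0) (\<lambda>l. infsum (?g l) UNIV)"
    unfolding fisher_eq_log_gap[OF \<mu> \<rho>]
  proof (rule infsum_le_Liminf_ereal, goal_cases)
    case (1 i)
    obtain x y where i: "i = (x, y)" by (cases i)
    have "((\<lambda>l. pmf (r l) x * (pmf (m l) y / pmf (r l) y))
        \<longlongrightarrow> pmf \<rho> x * (pmf \<mu> y / pmf \<rho> y)) (at_right 0)"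
      by (intro tendsto_intros lim) (use pos[of y] in linarith)
    then have "((\<lambda>l. ?g l i)
        \<longlongrightarrow> ereal (L x y * log_gap (pmf \<mu> x) (pmf \<rho> x * (pmf \<mu> y / pmf \<rho> y)))) (at_right 0)"
      unfolding i prod.case
      by (intro tendsto_ereal tendsto_mult[OF tendsto_const] young_gap_tendsto_log_gap lim)
        (use pos in auto)
    from lim_imp_Liminf[OF _ this] show ?case by (simp add: i)
  next
    case (2 i)
    then show ?case using fisher_summand_nonneg[OF L \<mu> \<rho>]
      by (auto split: prod.split simp del: times_divide_eq_right)
  next
    case 3
    from ev ev_l show ?case
    proof eventually_elim
      case (elim l)
      then show ?case
        using gen_fisher_summand_nonneg[OF L, of l _ _ "m l" "r l"]
        by (auto simp: gen_psi_eq_young_gap positive_pmfs_def)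
    qed
  qed
  also have "\<dots> \<le> Liminf (at_right 0) (\<lambda>l. gen_fisher L l (m l) (r l))"
    by (rule Liminf_mono, use ev in eventually_elim) (simp add: gen_fisher_eq_young_gap)
  finally show ?thesis .
qed

lemma gen_fisher_gamma_converges:
  assumes L: "generator L"
  shows "gamma_converges (subtopology l1_topology positive_pmfs) (gen_fisher L) (fisher L)"
  unfolding gamma_converges_def
proof (intro conjI allI impI ballI)
  fix \<mu> \<rho> :: "'a pmf"
  assume "\<mu> \<in> topspace (subtopology l1_topology positive_pmfs)"
    "\<rho> \<in> topspace (subtopology l1_topology positive_pmfs)"
  then have pos: "\<mu> \<in> positive_pmfs" "\<rho> \<in> positive_pmfs" by auto
  have "\<forall>\<^sub>F l in at_right 0. gen_fisher L l \<mu> \<rho> \<le> fisher L \<mu> \<rho>"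
    by (rule eventually_at_rightI[of 0 1]) (use gen_fisher_le_fisher[OF L _ _ pos] in auto)
  then have "Limsup (at_right 0) (\<lambda>l. gen_fisher L l \<mu> \<rho>) \<le> fisher L \<mu> \<rho>"
    by (rule Limsup_bounded)
  then show "\<exists>m r. (\<forall>l\<in>{0<..<1}. m l \<in> topspace (subtopology l1_topology positive_pmfs) \<and>
        r l \<in> topspace (subtopology l1_topology positive_pmfs)) \<and>
      limitin (subtopology l1_topology positive_pmfs) m \<mu> (at_right 0) \<and>
      limitin (subtopology l1_topology positive_pmfs) r \<rho> (at_right 0) \<and>
      Limsup (at_right 0) (\<lambda>l. gen_fisher L l (m l) (r l)) \<le> fisher L \<mu> \<rho>"
    using pos by (intro exI[of _ "\<lambda>_. \<mu>"] exI[of _ "\<lambda>_. \<rho>"]) (auto simp: limitin_const_iff)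
qed (use fisher_le_Liminf_gen_fisher[OF L] in blast)

theorem theorem1p6:
  fixes L :: "'a::countable \<Rightarrow> 'a \<Rightarrow> real"
  assumes "generator L"
  shows
    "(\<forall>l\<in>{0<..<1}.
        (\<forall>\<mu> \<rho>. 0 \<le> gen_fisher L l \<mu> \<rho>) \<and>
        lower_semicontinuous (prod_topology l1_topology l1_topology)
          (\<lambda>(\<mu>, \<rho>). gen_fisher L l \<mu> \<rho>)) \<and>
     (\<forall>l\<in>{0<..<1}. \<forall>\<mu> \<rho>. gen_fisher L l \<mu> \<rho> = 0 \<longrightarrow>
        (\<forall>C\<in>connected_comps L (set_pmf \<rho>). \<exists>c. \<forall>x\<in>C. pmf \<mu> x = c * pmf \<rho> x) \<and>
        (\<rho> \<in> positive_pmfs \<longrightarrow> \<mu> = \<rho>)) \<and>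
     gamma_converges (subtopology l1_topology positive_pmfs) (gen_fisher L) (fisher L)"
  using gen_fisher_nonneg[OF assms] gen_fisher_lower_semicontinuous[OF assms]
    gen_fisher_0_component[OF assms] gen_fisher_0_positive[OF assms]
    gen_fisher_gamma_converges[OF assms]
  by (intro conjI ballI allI impI) (simp_all, blast+)

end
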